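(* Let $(a_n)_{n\ge 1}$ and $(b_n)_{n\ge 1}$ be sequences of complex numbers, and let $(y_n)_{n\ge -1}$ be the sequence determined by given initial values $y_{-1},y_0\in\mathbb{C}$ and the homogeneous equation $$y_n-b_n y_{n-1}-a_n y_{n-2}=0,\qquad n\ge 1.$$ Assume that there exist sequences $(c_n)_{n\ge 1}$ and $(d_n)_{n\ge 1}$ of complex numbers satisfying $c_n+d_{n+1}=b_n$ and $c_n d_n=-a_n$ for every $n\ge 1$. Then for every $n\ge 1$, $$y_{n}=(y_0-d_1 y_{-1})\sum_{i=1}^{n+1}\prod_{j=1}^{i-1} c_j \prod_{j=i+1}^{n+1} d_j +y_{-1}\prod_{j=1}^{n+1} d_j .$$
   Context: Empty products are $1$. *)

theory Defs
  imports Complex_Main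
begin

end

theory Submission
  imports Defs
begin

text \<open>The factorisation of the characteristic relation splits the second-order recurrence into two
first-order ones: the differences $y_n - d_{n+1} y_{n-1}$ form a sequence with ratios $c_n$,
and $y$ is then recovered by solving $y_n = d_{n+1} y_{n-1} + (y_0 - d_1 y_{-1}) c_1 \cdots c_n$.\<close>

text \<open>For i \<le> m the second product contains \<open>d (Suc m)\<close>, which factors out;
  the new term i = m + 1 has an empty second product and contributes only c_1 ... c_m.\<close>

lemma sum_prod_prod_Suc:
  fixes c d :: "nat \<Rightarrow> 'a::comm_semiring_1"
  shows "(\<Sum>i = 1..Suc m. (\<Prod>j = 1..i - 1. c j) * (\<Prod>j = i + 1..Suc m. d j)) =
    d (Suc m) * (\<Sum>i = 1..m. (\<Prod>j = 1..i - 1. c j) * (\<Prod>j = i + 1..m. d j)) + (\<Prod>j = 1..m. c j)"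
proof -
  have "(\<Sum>i = 1..m. (\<Prod>j = 1..i - 1. c j) * (\<Prod>j = i + 1..Suc m. d j)) =
      (\<Sum>i = 1..m. d (Suc m) * ((\<Prod>j = 1..i - 1. c j) * (\<Prod>j = i + 1..m. d j)))"
    by (intro sum.cong) (auto simp: mult_ac)
  then show ?thesis
    by (simp add: sum_distrib_left)
qed

theorem theorem1p2:
  fixes a b c d :: "nat \<Rightarrow> complex" and y :: "int \<Rightarrow> complex"
  assumes rec: "\<And>n::nat. n \<ge> 1 \<Longrightarrow>
      y (int n) - b n * y (int n - 1) - a n * y (int n - 2) = 0"
    and cd_sum: "\<And>n::nat. n \<ge> 1 \<Longrightarrow> c n + d (n + 1) = b n"
    and cd_prod: "\<And>n::nat. n \<ge> 1 \<Longrightarrow> c n * d n = - a n"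
  shows "\<forall>n::nat. n \<ge> 1 \<longrightarrow>
      y (int n) =
        (y 0 - d 1 * y (- 1)) *
          (\<Sum>i = 1..n + 1. (\<Prod>j = 1..i - 1. c j) * (\<Prod>j = i + 1..n + 1. d j))
        + y (- 1) * (\<Prod>j = 1..n + 1. d j)"
proof (intro allI impI)
  fix n :: nat
  \<comment> \<open>Including n = 0 anchors the induction: there \<open>int n - 1\<close> is -1 and
    the product is empty.\<close>
  have diff: "y (int n) - d (n + 1) * y (int n - 1) = (y 0 - d 1 * y (- 1)) * (\<Prod>j = 1..n. c j)" for n
  proof (induction n)
    case 0
    show ?case by simp
  next
    case (Suc n)
    have "a (Suc n) = - (c (Suc n) * d (Suc n))"
      using cd_prod[of "Suc n"] by simp
    moreover have "b (Suc n) = c (Suc n) + d (Suc n + 1)"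
      using cd_sum[of "Suc n"] by simp
    moreover have "y (int (Suc n)) = b (Suc n) * y (int n) + a (Suc n) * y (int n - 1)"
      using rec[of "Suc n"] by (simp add: algebra_simps)
    \<comment> \<open>After substituting for \<open>b (Suc n)\<close> and \<open>a (Suc n)\<close>,
      the term \<open>d (Suc n + 1) * y (int n)\<close> cancels and \<open>c (Suc n)\<close> is a
      common factor of the rest.\<close>
    ultimately have "y (int (Suc n)) - d (Suc n + 1) * y (int n) =
        c (Suc n) * (y (int n) - d (n + 1) * y (int n - 1))"
      by (simp add: algebra_simps)
    then show ?case
      by (simp add: Suc.IH[simplified] mult_ac)
  qed
  show "y (int n) =
      (y 0 - d 1 * y (- 1)) *
        (\<Sum>i = 1..n + 1. (\<Prod>j = 1..i - 1. c j) * (\<Prod>j = i + 1..n + 1. d j))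
      + y (- 1) * (\<Prod>j = 1..n + 1. d j)"
  \<comment> \<open>At the base n = 0 the sum is the single term 1, so the right-hand side collapses
    to (y_0 - d_1 y_{-1}) + y_{-1} d_1 = y_0.\<close>
  proof (induction n)
    case 0
    show ?case by simp
  next
    case (Suc n)
    let ?S = "\<lambda>m. \<Sum>i = 1..m. (\<Prod>j = 1..i - 1. c j) * (\<Prod>j = i + 1..m. d j)"
    have S: "?S (Suc n + 1) = d (Suc n + 1) * ?S (n + 1) + (\<Prod>j = 1..Suc n. c j)"
      using sum_prod_prod_Suc[of c d "n + 1"] by simp
    have P: "(\<Prod>j = 1..Suc n + 1. d j) = d (Suc n + 1) * (\<Prod>j = 1..n + 1. d j)"
      by (simp add: mult_ac)
    have "y (int (Suc n)) = d (Suc n + 1) * y (int n) + (y 0 - d 1 * y (- 1)) * (\<Prod>j = 1..Suc n. c j)"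
      using diff[of "Suc n"] by (simp add: diff_eq_eq add.commute)
    \<comment> \<open>By \<open>S\<close> and \<open>P\<close> the closed form obeys the same
      first-order recurrence as y: both parts gain the factor \<open>d (Suc n + 1)\<close>, and the
      sum also gains c_1 ... c_{n+1}.\<close>
    then show ?case
      unfolding S P Suc.IH by (simp only: distrib_left mult_ac add_ac)
  qed
qed

end
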